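(* Let $m\ge 0$, $n=m+3$, and let $\mathcal F=(W_{i,j})$ be a closed decorated frieze of width $m$. Then $$W_{i+n,j+n}=W_{i,j}$$ for all $i,j\in\mathbb Z$ with $0\le j-i\le n$. Moreover, since the boundary decorations $y_1,\dots,y_n$ are algebraically independent variables, $n$ is the least positive period of $\mathcal F$, i.e. the least integer $p>0$ such that $W_{i+p,j+p}=W_{i,j}$ for all $i,j\in\mathbb Z$ with $0\le j-i\le n$.
   Context: Fix an integer $m\ge 0$ and put $n=m+3$. Let $x_1,\dots,x_m,y_1,\dots,y_n$ be algebraically independent variables, extend $y_{i+n}=y_i$ for $i\in\mathbb Z$, and put $\mathscr R_m=\mathbb Z[x_1^{\pm1},\dots,x_m^{\pm1},y_1^{\pm1},\dots,y_n^{\pm1}]$. A closed decorated frieze of width $m$ is a family $\mathcal F=(W_{i,j})$ of elements of $\mathscr R_m$, indexed by $i,j\in\mathbb Z$ with $0\le j-i\le n$, such that: (D1) $W_{i,i}=0$ and $W_{i,i+n}=0$ for all $i$; (D2) $W_{i,i+1}=y_i$ and $W_{i,i+n-1}=y_{i-1}$ for all $i$; (D3) every interior entry, i.e. every $W_{i,j}$ with $2\le j-i\le n-2$, is nonzero; (D4) for all $i,j$ with $1\le j-i\le n-1$, $W_{i,j}W_{i+1,j+1}-W_{i+1,j}W_{i,j+1}=y_iy_j$. No periodicity of the entries is assumed. *)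

theory Defs
  imports Main "HOL-Library.Poly_Mapping"
begin

datatype laurent_var = XVar nat | YVar nat

text \<open>Integer Laurent polynomials in all the variables \<open>XVar k\<close>, \<open>YVar k\<close>, as the group ring over
  the integers of the free abelian group on the variables: a monomial is a finitely supported
  function from variables to integer exponents, and multiplication is the convolution product.\<close>

type_synonym laurent = "(laurent_var \<Rightarrow>\<^sub>0 int) \<Rightarrow>\<^sub>0 int"

text \<open>The Laurent polynomials involving only \<open>x\<^sub>1, \<dots>, x\<^sub>m\<close> and \<open>y\<^sub>1, \<dots>, y\<^sub>n\<close>, where \<open>n = m + 3\<close>.\<close>

definition laurent_ring :: "nat \<Rightarrow> laurent set" where
  "laurent_ring m =
    {f. \<forall>u \<in> Poly_Mapping.keys f. Poly_Mapping.keys u \<subseteq> XVar ` {1..m} \<union> YVar ` {1..m + 3}}"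

definition laurent_gen :: "laurent_var \<Rightarrow> laurent" where
  "laurent_gen v = Poly_Mapping.single (Poly_Mapping.single v 1) 1"

text \<open>The variable \<open>y\<^sub>i\<close> for an arbitrary integer \<open>i\<close>, with \<open>i\<close> reduced to its representative
  in \<open>{1..n}\<close> modulo \<open>n = m + 3\<close>.\<close>

definition yvar :: "nat \<Rightarrow> int \<Rightarrow> laurent" where
  "yvar m i = laurent_gen (YVar (nat ((i - 1) mod (int m + 3) + 1)))"

text \<open>The family is a total function of two integers, but only its values at \<open>i, j\<close> with
  \<open>0 \<le> j - i \<le> n\<close> are entries of the frieze; the other values are left unconstrained.\<close>

definition closed_decorated_frieze :: "nat \<Rightarrow> (int \<Rightarrow> int \<Rightarrow> laurent) \<Rightarrow> bool" where
  "closed_decorated_frieze m W \<longleftrightarrow>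
    (let n = int m + 3; y = yvar m in
      (\<forall>i j. 0 \<le> j - i \<and> j - i \<le> n \<longrightarrow> W i j \<in> laurent_ring m) \<and>
      (\<forall>i. W i i = 0 \<and> W i (i + n) = 0) \<and>
      (\<forall>i. W i (i + 1) = y i \<and> W i (i + n - 1) = y (i - 1)) \<and>
      (\<forall>i j. 2 \<le> j - i \<and> j - i \<le> n - 2 \<longrightarrow> W i j \<noteq> 0) \<and>
      (\<forall>i j. 1 \<le> j - i \<and> j - i \<le> n - 1 \<longrightarrow>
         W i j * W (i + 1) (j + 1) - W (i + 1) j * W i (j + 1) = y i * y j))"

definition frieze_period :: "nat \<Rightarrow> (int \<Rightarrow> int \<Rightarrow> laurent) \<Rightarrow> int \<Rightarrow> bool" where
  "frieze_period m W p \<longleftrightarrow>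
    (\<forall>i j. 0 \<le> j - i \<and> j - i \<le> int m + 3 \<longrightarrow> W (i + p) (j + p) = W i j)"

end

(* Fix j and let c be the entry W (j-1) (j+1).  Subtracting two neighbouring diamond relations and
   cancelling a nonzero entry shows, by descending induction on i, that
   c * W i j = y j * W i (j-1) + y (j-1) * W i (j+1).  At i = j + 1 - n the last entry vanishes
   and the relation becomes W (j+1-n) (j-1) = W (j-1) (j+1): the glide reflection
   (i,j) |-> (j, i+n) fixes the entries with j - i = n - 2.  Both the frieze and its reflection
   satisfy the diamond relation, which determines all remaining entries, so the glide reflection
   is a symmetry; its square is the translation by n.  Conversely a period of the frieze is a
   period of the boundary decorations, hence a multiple of n. *)

theory Submission
  imports Defs
begin

text \<open>A linear order on the variables makes Laurent polynomials an integral domain.\<close>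

instantiation laurent_var :: linorder
begin

text \<open>Even and odd codes separate the two families of variables, so the code is injective and
  the order it induces is antisymmetric.\<close>

fun var_code :: "laurent_var \<Rightarrow> nat" where
  "var_code (XVar k) = 2 * k"
| "var_code (YVar k) = 2 * k + 1"

definition less_eq_laurent_var :: "laurent_var \<Rightarrow> laurent_var \<Rightarrow> bool" where
  "u \<le> v \<longleftrightarrow> var_code u \<le> var_code v"

definition less_laurent_var :: "laurent_var \<Rightarrow> laurent_var \<Rightarrow> bool" where
  "u < v \<longleftrightarrow> var_code u < var_code v"

instance
proof
  fix u v :: laurent_var
  show "u \<le> v \<Longrightarrow> v \<le> u \<Longrightarrow> u = v"
    unfolding less_eq_laurent_var_def by (cases u; cases v; simp; presburger)
qed (auto simp: less_eq_laurent_var_def less_laurent_var_def)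

end

lemma laurent_gen_eq_iff: "laurent_gen u = laurent_gen v \<longleftrightarrow> u = v"
proof
  assume "laurent_gen u = laurent_gen v"
  then have "Poly_Mapping.keys (laurent_gen u) = Poly_Mapping.keys (laurent_gen v)"
    by simp
  then have "Poly_Mapping.single u (1::int) = Poly_Mapping.single v 1"
    by (simp add: laurent_gen_def)
  then have "Poly_Mapping.keys (Poly_Mapping.single u (1::int))
      = Poly_Mapping.keys (Poly_Mapping.single v (1::int))"
    by simp
  then show "u = v"
    by simp
qed simp

lemma laurent_gen_nonzero: "laurent_gen v \<noteq> 0"
proof
  assume "laurent_gen v = 0"
  then have "Poly_Mapping.keys (laurent_gen v) = {}"
    by simp
  then show False
    by (simp add: laurent_gen_def)
qed

lemma yvar_nonzero: "yvar m i \<noteq> 0"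
  by (simp add: yvar_def laurent_gen_nonzero)

lemma yvar_eq_iff: "yvar m i = yvar m j \<longleftrightarrow> (i - 1) mod (int m + 3) = (j - 1) mod (int m + 3)"
  by (simp add: yvar_def laurent_gen_eq_iff eq_nat_nat_iff)

lemma yvar_shift: "yvar m (i + (int m + 3)) = yvar m i"
proof -
  have "i + (int m + 3) - 1 = (i - 1) + (int m + 3)"
    by simp
  then show ?thesis
    unfolding yvar_eq_iff by (metis mod_add_self2)
qed

locale decorated_frieze =
  fixes m :: nat and W :: "int \<Rightarrow> int \<Rightarrow> laurent" and n :: int and y :: "int \<Rightarrow> laurent"
  assumes frieze: "closed_decorated_frieze m W"
  defines "n \<equiv> int m + 3" and "y \<equiv> yvar m"
begin

lemma n_ge: "n \<ge> 3"
  by (simp add: n_def)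

lemma border_0: "W i i = 0" "W i (i + n) = 0"
  using frieze by (simp_all add: closed_decorated_frieze_def Let_def n_def)

lemma border_1: "W i (i + 1) = y i" "W i (i + n - 1) = y (i - 1)"
  using frieze by (simp_all add: closed_decorated_frieze_def Let_def n_def y_def)

lemma diamond:
  assumes "1 \<le> j - i" "j - i \<le> n - 1"
  shows "W i j * W (i + 1) (j + 1) - W (i + 1) j * W i (j + 1) = y i * y j"
  using frieze assms by (simp add: closed_decorated_frieze_def Let_def n_def y_def)

lemma y_nonzero: "y i \<noteq> 0"
  by (simp add: y_def yvar_nonzero)

lemma y_shift: "y (i + n) = y i"
  by (simp add: y_def n_def yvar_shift)

text \<open>Next to the zero borders stand single variables, so nonvanishing extends from the
  interior to these rows. This justifies cancelling entries in the integral domain of Laurent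
  polynomials.\<close>

lemma entry_nonzero:
  assumes "1 \<le> j - i" "j - i \<le> n - 1"
  shows "W i j \<noteq> 0"
proof -
  consider "j = i + 1" | "j = i + n - 1" | "2 \<le> j - i" "j - i \<le> n - 2"
    using assms by linarith
  then show ?thesis
  proof cases
    case 3
    then show ?thesis
      using frieze by (simp add: closed_decorated_frieze_def Let_def n_def)
  qed (simp_all add: border_1 y_nonzero)
qed

lemma three_term_recurrence:
  assumes "i \<le> j - 1" "j - i \<le> n - 1"
  shows "W (j - 1) (j + 1) * W i j = y j * W i (j - 1) + y (j - 1) * W i (j + 1)"
  using assms
proof (induction i rule: int_le_induct)
  case base
  show ?case
    using border_0(1)[of "j - 1"] border_1(1)[of "j - 1"] by (simp add: mult.commute)
next
  case (step i)
  have IH: "W (j - 1) (j + 1) * W i j = y j * W i (j - 1) + y (j - 1) * W i (j + 1)"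
    using step by simp
  have left: "W (i - 1) (j - 1) * W i j - W i (j - 1) * W (i - 1) j = y (i - 1) * y (j - 1)"
    using diamond[of "j - 1" "i - 1"] step by simp
  have right: "W (i - 1) j * W i (j + 1) - W i j * W (i - 1) (j + 1) = y (i - 1) * y j"
    using diamond[of j "i - 1"] step by simp
  \<comment> \<open>Expanding with \<open>left\<close> and \<open>right\<close>, the two terms
    \<open>y (i - 1) * y (j - 1) * y j\<close> cancel; what remains is \<open>W (i - 1) j\<close>
    times the right side of \<open>IH\<close>.\<close>
  have "W i j * (y j * W (i - 1) (j - 1) + y (j - 1) * W (i - 1) (j + 1))
      = W i j * (W (j - 1) (j + 1) * W (i - 1) j)"
    using IH left right by algebra
  moreover have "W i j \<noteq> 0"
    using step by (intro entry_nonzero) auto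
  ultimately show ?case
    by simp
qed

lemma glide_subborder:
  assumes "j = i + n - 2"
  shows "W i j = W j (i + n)"
proof -
  have j: "j + 1 = i + n - 1" "j + 1 + 1 = i + n"
    using assms by simp_all
  \<comment> \<open>Periodicity of \<open>y\<close> makes the border entry and the coefficient in
    the recurrence the same variable, which can then be cancelled.\<close>
  have "W i (j + 1) = y (i - 1)" "W i (j + 1 + 1) = 0" "y (j + 1) = y (i - 1)"
    using border_1(2)[of i] border_0(2)[of i] y_shift[of "i - 1"] unfolding j
    by (simp_all add: algebra_simps)
  moreover have "W j (j + 1 + 1) * W i (j + 1) = y (j + 1) * W i j + y j * W i (j + 1 + 1)"
    using three_term_recurrence[of i "j + 1"] assms n_ge by simp
  ultimately have "W j (i + n) * y (i - 1) = y (i - 1) * W i j"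
    using j(2) by simp
  then show ?thesis
    by (simp add: y_nonzero mult.commute)
qed

text \<open>The diamond relation computes each diagonal from the two longer ones beside it, so the
  induction carries two adjacent diagonals, starting at \<open>j - i = n - 1\<close> and
  \<open>n - 2\<close> and descending to \<open>j - i = 0\<close>.\<close>

lemma glide_pair:
  assumes "int k \<le> n - 2"
  shows "(\<forall>i. W i (i + n - 1 - int k) = W (i + n - 1 - int k) (i + n)) \<and>
    (\<forall>i. W i (i + n - 2 - int k) = W (i + n - 2 - int k) (i + n))"
  using assms
proof (induction k)
  case 0
  have "W i (i + n - 1) = W (i + n - 1) (i + n)" for i
    using border_1(2)[of i] border_1(1)[of "i + n - 1"] y_shift[of "i - 1"]
    by (simp add: algebra_simps)
  then show ?case
    using glide_subborder by simp
next
  case (Suc k)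
  have up: "W i j = W j (i + n)" if "j - i = n - 1 - int k" for i j
  proof -
    have "j = i + n - 1 - int k"
      using that by simp
    then show ?thesis
      using Suc by simp
  qed
  have mid: "W i j = W j (i + n)" if "j - i = n - 2 - int k" for i j
  proof -
    have "j = i + n - 2 - int k"
      using that by simp
    then show ?thesis
      using Suc by simp
  qed
  have down: "W i j = W j (i + n)" if d: "j - i = n - 3 - int k" for i j
  proof -
    have "W (i - 1) j * W i (j + 1) - W i j * W (i - 1) (j + 1) = y (i - 1) * y j"
      using diamond[of j "i - 1"] d Suc.prems by simp
    \<comment> \<open>This is the diamond at the reflected position; its right side agrees with the
      previous one because \<open>y\<close> has period \<open>n\<close>.\<close>
    moreover have "W j (i - 1 + n) * W (j + 1) (i + n) - W (j + 1) (i - 1 + n) * W j (i + n)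
        = y j * y (i - 1)"
      using diamond[of "i - 1 + n" j] d Suc.prems y_shift[of "i - 1"] by (simp add: algebra_simps)
    moreover have "W (i - 1) j = W j (i - 1 + n)" "W i (j + 1) = W (j + 1) (i + n)"
      by (rule mid; use d in simp)+
    moreover have "W (i - 1) (j + 1) = W (j + 1) (i - 1 + n)"
      by (rule up; use d in simp)
    ultimately have "W (i - 1) (j + 1) * W i j = W (i - 1) (j + 1) * W j (i + n)"
      by algebra
    moreover have "W (i - 1) (j + 1) \<noteq> 0"
      using d Suc.prems by (intro entry_nonzero) auto
    ultimately show ?thesis
      by simp
  qed
  show ?case
    by (intro conjI allI mid down) auto
qed

lemma glide:
  assumes "0 \<le> j - i" "j - i \<le> n"
  shows "W i j = W j (i + n)"
proof -
  consider "j = i + n" | "j = i" | "1 \<le> j - i" "j - i \<le> n - 1"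
    using assms by linarith
  then show ?thesis
  proof cases
    case 3
    have "i + n - 1 - int (nat (n - 1 - (j - i))) = j"
      using 3 by simp
    moreover have "int (nat (n - 1 - (j - i))) \<le> n - 2"
      using 3 by simp
    ultimately show ?thesis
      using glide_pair by metis
  qed (simp_all add: border_0)
qed

lemma translation:
  assumes "0 \<le> j - i" "j - i \<le> n"
  shows "W (i + n) (j + n) = W i j"
  \<comment> \<open>The reflected pair \<open>(j, i + n)\<close> has difference
    \<open>n - (j - i)\<close>, again within range, so the glide applies twice.\<close>
  using glide[of j i] glide[of "i + n" j] assms by simp

lemma period_ge:
  assumes "p > 0" "frieze_period m W p"
  shows "n \<le> p"
proof -
  \<comment> \<open>Index 1 has residue 0 in \<open>yvar\<close>, so comparing decorations yields
    \<open>p mod n = 0\<close> directly.\<close>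
  have "W (1 + p) (2 + p) = W 1 2"
    using assms(2) by (simp add: frieze_period_def)
  then have "y (1 + p) = y 1"
    using border_1(1)[of 1] border_1(1)[of "1 + p"] by (simp add: algebra_simps)
  then have "p mod n = 0"
    by (simp add: y_def yvar_eq_iff n_def)
  with assms(1) show ?thesis
    by (auto intro: zdvd_imp_le)
qed

end

theorem theorem1p1:
  fixes m :: nat and n :: int and W :: "int \<Rightarrow> int \<Rightarrow> laurent"
  assumes n: "n = int m + 3"
    and frieze: "closed_decorated_frieze m W"
  shows "(\<forall>i j. 0 \<le> j - i \<and> j - i \<le> n \<longrightarrow> W (i + n) (j + n) = W i j) \<and>
    (n > 0 \<and> frieze_period m W n \<and> (\<forall>p>0. frieze_period m W p \<longrightarrow> n \<le> p))"
proof -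
  interpret decorated_frieze m W "int m + 3" "yvar m"
    by unfold_locales (simp_all add: frieze)
  show ?thesis
    unfolding n frieze_period_def
    using translation period_ge by (auto simp: frieze_period_def)
qed

end
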